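(* $\mathfrak a\le\mathfrak o$.
   Context: Two infinite sets are almost disjoint if their intersection is finite. $\mathfrak a$ is the minimum cardinality of an infinite maximal almost disjoint family of infinite subsets of $\omega$. Let ${}^{<\omega}\omega$ be the tree of finite sequences of natural numbers ordered by initial segment; a branch is a maximal linearly ordered set of nodes. An infinite set $A$ of nodes is off-branch if $A$ is almost disjoint from every branch; an off-branch family is a pairwise almost disjoint family of off-branch sets, maximal if no off-branch set is almost disjoint from all of its members. $\mathfrak o$ is the minimum cardinality of a maximal off-branch family. *)

theory Defs
  imports Main "HOL-Library.Sublist" "HOL-Library.Nat_Bijection"
begin

unbundle cardinal_syntax

definition almost_disjoint :: "'a set \<Rightarrow> 'a set \<Rightarrow> bool"
  where "almost_disjoint A B \<longleftrightarrow> finite (A \<inter> B)"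

definition almost_disjoint_family :: "nat set set \<Rightarrow> bool"
  where "almost_disjoint_family F \<longleftrightarrow> (\<forall>A\<in>F. infinite A) \<and> pairwise almost_disjoint F"

definition maximal_almost_disjoint_family :: "nat set set \<Rightarrow> bool"
  where "maximal_almost_disjoint_family F \<longleftrightarrow>
    almost_disjoint_family F \<and> (\<forall>G. almost_disjoint_family G \<and> F \<subseteq> G \<longrightarrow> G = F)"

text \<open>
  The nodes of the tree are the elements of \<open>nat list\<close>; \<open>strict_prefix\<close> is its strict order,
  and the chains of \<open>pred_on\<close> are taken with respect to the reflexive closure.
\<close>

definition branch :: "nat list set \<Rightarrow> bool"
  where "branch = pred_on.maxchain UNIV strict_prefix"

definition off_branch :: "nat list set \<Rightarrow> bool"
  where "off_branch A \<longleftrightarrow> infinite A \<and> (\<forall>b. branch b \<longrightarrow> almost_disjoint A b)"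

definition off_branch_family :: "nat list set set \<Rightarrow> bool"
  where "off_branch_family F \<longleftrightarrow> (\<forall>A\<in>F. off_branch A) \<and> pairwise almost_disjoint F"

definition maximal_off_branch_family :: "nat list set set \<Rightarrow> bool"
  where "maximal_off_branch_family F \<longleftrightarrow>
    off_branch_family F \<and> \<not> (\<exists>A. off_branch A \<and> (\<forall>B\<in>F. almost_disjoint A B))"

text \<open>
  Cardinals are represented by cardinal orders, which are determined only up to isomorphism;
  \<open>SOME\<close> picks one of minimum size.  The value is arbitrary if \<open>C\<close> is empty.
\<close>

definition min_cardinality :: "'a set set \<Rightarrow> 'a rel"
  where "min_cardinality C = (SOME r. \<exists>A\<in>C. r = |A| \<and> (\<forall>B\<in>C. |A| \<le>o |B| ))"

definition cardinal_a :: "nat set rel"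
  where "cardinal_a = min_cardinality {F. infinite F \<and> maximal_almost_disjoint_family F}"

definition cardinal_o :: "nat list set rel"
  where "cardinal_o = min_cardinality {F. maximal_off_branch_family F}"

lemma min_cardinality:
  assumes "C \<noteq> {}"
  shows "\<exists>A\<in>C. min_cardinality C = |A| \<and> (\<forall>B\<in>C. |A| \<le>o |B| )"
proof -
  have "\<exists>r\<in>card_of ` C. \<forall>r'\<in>card_of ` C. r \<le>o r'"
    using assms by (intro exists_minim_Card_order) (auto simp: card_of_Card_order)
  then have "\<exists>r. \<exists>A\<in>C. r = |A| \<and> (\<forall>B\<in>C. |A| \<le>o |B| )"
    by blast
  then show ?thesis
    unfolding min_cardinality_def by (rule someI_ex)
qed

lemma pairwise_Union_chain:
  assumes "subset.chain \<A> C" and "\<And>F. F \<in> C \<Longrightarrow> pairwise R F"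
  shows "pairwise R (\<Union>C)"
proof (rule pairwiseI)
  fix x y assume "x \<in> \<Union>C" "y \<in> \<Union>C" "x \<noteq> y"
  then obtain F G where FG: "F \<in> C" "x \<in> F" "G \<in> C" "y \<in> G" by blast
  then have "F \<subseteq> G \<or> G \<subseteq> F"
    using assms(1) by (auto simp: subset.chain_def)
  then show "R x y"
    using FG assms(2) \<open>x \<noteq> y\<close> by (metis pairwiseD subsetD)
qed

text \<open>The two minima are attained, so neither of the cardinals is a value of \<open>SOME\<close> at an
  unsatisfiable predicate.\<close>

lemma infinite_maximal_almost_disjoint_family_exists:
  "\<exists>F. infinite F \<and> maximal_almost_disjoint_family F"
proof -
  define c where "c i = range (\<lambda>j. prod_encode (i, j))" for i :: nat
  have inf_c: "infinite (c i)" for i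
    by (auto simp: c_def inj_def finite_image_iff)
  have disj_c: "c i \<inter> c j = {}" if "i \<noteq> j" for i j
    using that by (auto simp: c_def)
  have "inj c"
  proof (rule injI, rule ccontr)
    fix i j assume "c i = c j" "i \<noteq> j"
    then show False
      using disj_c[of i j] inf_c[of j] by simp
  qed
  then have inf_range: "infinite (range c)"
    by (simp add: finite_image_iff)
  let ?A = "{F. range c \<subseteq> F \<and> almost_disjoint_family F}"
  have range_ad: "range c \<in> ?A"
  proof -
    have "almost_disjoint (c i) (c j)" if "c i \<noteq> c j" for i j
      using that disj_c[of i j] by (cases "i = j") (auto simp: almost_disjoint_def)
    then show ?thesis
      using inf_c by (auto simp: almost_disjoint_family_def pairwise_def)
  qed
  have "\<exists>M\<in>?A. \<forall>X\<in>?A. M \<subseteq> X \<longrightarrow> X = M"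
  proof (rule subset_Zorn_nonempty)
    show "?A \<noteq> {}" using range_ad by blast
    fix C assume C: "C \<noteq> {}" "subset.chain ?A C"
    then have sub: "C \<subseteq> ?A" by (simp add: subset.chain_def)
    have "pairwise almost_disjoint (\<Union>C)"
      by (rule pairwise_Union_chain[OF C(2)]) (use sub in \<open>auto simp: almost_disjoint_family_def\<close>)
    moreover have "\<forall>A\<in>\<Union>C. infinite A"
      using sub by (auto simp: almost_disjoint_family_def)
    moreover have "range c \<subseteq> \<Union>C"
      using sub C(1) by blast
    ultimately show "\<Union>C \<in> ?A"
      by (simp add: almost_disjoint_family_def)
  qed
  then obtain M where "M \<in> ?A" and max: "\<forall>X\<in>?A. M \<subseteq> X \<longrightarrow> X = M" ..
  then have M: "range c \<subseteq> M" "almost_disjoint_family M" by simp_all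
  have "infinite M"
    using inf_range M(1) finite_subset by blast
  moreover have "maximal_almost_disjoint_family M"
    unfolding maximal_almost_disjoint_family_def
  proof (intro conjI allI impI)
    show "almost_disjoint_family M" by (fact M(2))
    fix G assume G: "almost_disjoint_family G \<and> M \<subseteq> G"
    then have "G \<in> ?A" using M(1) by auto
    then show "G = M" using G max by simp
  qed
  ultimately show ?thesis by blast
qed

lemma maximal_off_branch_family_exists: "\<exists>F. maximal_off_branch_family F"
proof -
  let ?A = "{F. off_branch_family F}"
  have "\<exists>M\<in>?A. \<forall>X\<in>?A. M \<subseteq> X \<longrightarrow> X = M"
  proof (rule subset_Zorn')
    fix C assume C: "subset.chain ?A C"
    then have sub: "C \<subseteq> ?A" by (simp add: subset.chain_def)
    have "pairwise almost_disjoint (\<Union>C)"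
      by (rule pairwise_Union_chain[OF C]) (use sub in \<open>auto simp: off_branch_family_def\<close>)
    then show "\<Union>C \<in> ?A"
      using sub by (auto simp: off_branch_family_def)
  qed
  then obtain M where "M \<in> ?A" and max: "\<forall>X\<in>?A. M \<subseteq> X \<longrightarrow> X = M" ..
  then have M: "off_branch_family M" by simp
  have "\<not> (off_branch A \<and> (\<forall>B\<in>M. almost_disjoint A B))" for A
  proof
    assume A: "off_branch A \<and> (\<forall>B\<in>M. almost_disjoint A B)"
    then have "off_branch_family (insert A M)"
      using M by (auto simp: off_branch_family_def pairwise_insert almost_disjoint_def Int_commute)
    then have "insert A M = M" by (intro max[rule_format]) auto
    then have "A \<in> M" by auto
    then show False
      using A by (auto simp: almost_disjoint_def off_branch_def)
  qed
  with M show ?thesis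
    unfolding maximal_off_branch_family_def by blast
qed

lemma cardinal_a:
  "\<exists>F. infinite F \<and> maximal_almost_disjoint_family F \<and> cardinal_a = |F| \<and>
    (\<forall>G. infinite G \<and> maximal_almost_disjoint_family G \<longrightarrow> |F| \<le>o |G| )"
  using min_cardinality[of "{F. infinite F \<and> maximal_almost_disjoint_family F}"]
    infinite_maximal_almost_disjoint_family_exists
  unfolding cardinal_a_def by blast

lemma cardinal_o:
  "\<exists>F. maximal_off_branch_family F \<and> cardinal_o = |F| \<and>
    (\<forall>G. maximal_off_branch_family G \<longrightarrow> |F| \<le>o |G| )"
  using min_cardinality[of "{F. maximal_off_branch_family F}"] maximal_off_branch_family_exists
  unfolding cardinal_o_def by blast

end

(* Restrict a maximal off-branch family to the comb of nodes n # replicate k 0. The branches that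
   meet the comb in an infinite set are the countably many columns "n fixed", so an infinite subset
   of the comb that is almost disjoint from all columns is off-branch. The columns and the infinite
   traces of the family on the comb therefore form a maximal almost disjoint family on a countable
   set. Adding countably many columns does not increase the cardinality, since a maximal off-branch
   family is infinite. *)
theory Submission
  imports Defs
begin

text \<open>The root is left out so that distinct columns are disjoint; adding it back turns each
  column into a branch.\<close>

definition column :: "nat \<Rightarrow> nat list set"
  where "column n = range (\<lambda>k. n # replicate k 0)"

text \<open>An injective numbering of the comb by natural numbers. Preimages under it turn sets of
  nodes into subsets of \<omega>, where \<a> is defined.\<close>

definition comb_node :: "nat \<Rightarrow> nat list"
  where "comb_node i = (case prod_decode i of (n, k) \<Rightarrow> n # replicate k 0)"

lemma comb_node_prod_encode [simp]: "comb_node (prod_encode (n, k)) = n # replicate k 0"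
  by (simp add: comb_node_def)

lemma inj_comb_node: "inj comb_node"
proof (rule injI)
  fix i j assume "comb_node i = comb_node j"
  moreover obtain m k n l where "i = prod_encode (m, k)" "j = prod_encode (n, l)"
    by (metis prod_decode_inverse surj_pair)
  ultimately show "i = j" by simp
qed

lemma range_comb_node: "range comb_node = (\<Union>n. column n)"
proof -
  have "comb_node i \<in> (\<Union>n. column n)" for i
    by (auto simp: comb_node_def column_def split: prod.split)
  moreover have "n # replicate k 0 \<in> range comb_node" for n k
    by (metis comb_node_prod_encode rangeI)
  ultimately show ?thesis by (auto simp: column_def)
qed

lemma vimage_comb_node_column: "comb_node -` column n = range (\<lambda>k. prod_encode (n, k))"
proof -
  have "column n = comb_node ` range (\<lambda>k. prod_encode (n, k))"
    by (simp add: column_def image_image)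
  then show ?thesis by (simp add: inj_vimage_image_eq inj_comb_node)
qed

lemma infinite_vimage_comb_node_column: "infinite (comb_node -` column n)"
  by (simp add: vimage_comb_node_column finite_image_iff inj_def)

lemma column_disjoint: "m \<noteq> n \<Longrightarrow> column m \<inter> column n = {}"
  by (auto simp: column_def)

lemma chain_strict_prefix_comparable:
  assumes "pred_on.chain UNIV strict_prefix C" "x \<in> C" "y \<in> C"
  shows "prefix x y \<or> prefix y x"
proof -
  have "x = y \<or> strict_prefix x y \<or> strict_prefix y x"
    using assms unfolding pred_on.chain_def by blast
  then show ?thesis by (auto simp: strict_prefix_def)
qed

text \<open>Any node in a chain containing the column is comparable with a longer node of that
  column, hence is an initial segment of it: the root or a column node.\<close>

lemma branch_insert_Nil_column: "branch (insert [] (column n))"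
proof -
  let ?b = "insert [] (column n)"
  have cmp: "x = y \<or> strict_prefix x y \<or> strict_prefix y x" if "x \<in> ?b" "y \<in> ?b" for x y
  proof -
    have "prefix (replicate j (0::nat)) (replicate k 0)" if "j \<le> k" for j k
      using that by (metis le_add_diff_inverse prefixI replicate_add)
    then have rep: "prefix (replicate j (0::nat)) (replicate k 0) \<or>
        prefix (replicate k (0::nat)) (replicate j 0)" for j k
      by (meson linear)
    have "prefix x y \<or> prefix y x"
      using that by (auto simp: column_def) (use rep in blast)
    then show ?thesis by (auto simp: strict_prefix_def)
  qed
  have "x \<in> ?b" if "C \<supseteq> ?b" "x \<in> C" and chain: "pred_on.chain UNIV strict_prefix C" for C x
  proof -
    \<comment> \<open>The length of \<open>y\<close> is \<open>length x + 1\<close>, which rules out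
      that \<open>y\<close> is a prefix of \<open>x\<close>.\<close>
    define y where "y = n # replicate (length x) 0"
    have "y \<in> C" using that(1) by (auto simp: y_def column_def)
    then have "prefix x y \<or> prefix y x"
      using chain \<open>x \<in> C\<close> chain_strict_prefix_comparable by blast
    then have "prefix x y"
      using prefix_length_le[of y x] by (auto simp: y_def)
    then have x: "x = take (length x) y"
      by (metis append_eq_conv_conj prefix_def)
    show ?thesis
    proof (cases "length x")
      case (Suc k)
      then have "x = n # replicate k 0" using x by (simp add: y_def del: replicate_Suc)
      then show ?thesis by (simp add: column_def)
    qed simp
  qed
  then have "\<not> ?b \<subset> C" if "pred_on.chain UNIV strict_prefix C" for C
    using that by blast
  moreover have "pred_on.chain UNIV strict_prefix ?b"
    unfolding pred_on.chain_def using cmp by blast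
  ultimately show ?thesis
    unfolding branch_def pred_on.maxchain_def by blast
qed

lemma off_branch_Int_column:
  assumes "off_branch A"
  shows "finite (A \<inter> column n)"
proof (rule finite_subset)
  show "finite (A \<inter> insert [] (column n))"
    using assms branch_insert_Nil_column by (simp add: off_branch_def almost_disjoint_def)
qed blast

text \<open>Comparable nodes of the comb are nonempty and share their first entry, so any branch
  meets \<open>A\<close> inside a single column.\<close>

lemma off_branchI_columns:
  assumes "infinite A" and sub: "A \<subseteq> range comb_node" and fin: "\<And>n. finite (A \<inter> column n)"
  shows "off_branch A"
  unfolding off_branch_def almost_disjoint_def
proof (intro conjI allI impI)
  fix b assume b: "branch b"
  show "finite (A \<inter> b)"
  proof (cases "A \<inter> b = {}")
    case False
    then obtain x n where x: "x \<in> A" "x \<in> b" "x \<in> column n"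
      using sub range_comb_node by blast
    have "y \<in> column n" if "y \<in> A \<inter> b" for y
    proof -
      obtain m where m: "y \<in> column m" using \<open>y \<in> A \<inter> b\<close> sub range_comb_node by blast
      have "prefix x y \<or> prefix y x" 
        using b x that chain_strict_prefix_comparable
        by (auto simp: branch_def pred_on.maxchain_def)
      then have "m = n" using x(3) m by (auto simp: column_def)
      then show ?thesis using m by simp
    qed
    then have "A \<inter> b \<subseteq> A \<inter> column n" by blast
    then show ?thesis using fin finite_subset by blast
  qed simp
qed fact

text \<open>Diagonalization: finitely many off-branch sets cover only a finite part of each column.
  Choosing one uncovered node per column gives an off-branch set disjoint from all of them, against
  maximality.\<close>

lemma infinite_maximal_off_branch_family:
  assumes "maximal_off_branch_family F"
  shows "infinite F"
proof
  assume fin: "finite F"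
  have off: "\<And>A. A \<in> F \<Longrightarrow> off_branch A"
    using assms by (simp add: maximal_off_branch_family_def off_branch_family_def)
  have "\<exists>x. x \<in> column n - \<Union>F" for n
  proof -
    have "finite (\<Union>A\<in>F. A \<inter> column n)"
      using fin off off_branch_Int_column by blast
    moreover have "infinite (column n)"
      using infinite_vimage_comb_node_column finite_vimageI inj_comb_node by blast
    ultimately have "column n - (\<Union>A\<in>F. A \<inter> column n) \<noteq> {}"
      by (metis Diff_infinite_finite finite.emptyI)
    then show ?thesis by blast
  qed
  then obtain f where f: "\<And>n. f n \<in> column n - \<Union>F" by metis
  \<comment> \<open>Disjointness of the columns yields both the injectivity of \<open>f\<close> and
    that its range meets each column in one node only.\<close>
  have eq: "m = n" if "f m \<in> column n" for m n
    using that f[of m] column_disjoint[of m n] by blast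
  then have "inj f" by (metis DiffD1 f injI)
  then have "infinite (range f)" by (simp add: finite_image_iff)
  moreover have "range f \<subseteq> range comb_node"
    using f range_comb_node by blast
  moreover have "finite (range f \<inter> column n)" for n
    by (rule finite_subset[of _ "{f n}"]) (use eq in auto)
  ultimately have "off_branch (range f)" by (rule off_branchI_columns)
  moreover have "\<forall>B\<in>F. range f \<inter> B = {}" using f by blast
  ultimately show False
    using assms unfolding maximal_off_branch_family_def almost_disjoint_def
    by (metis finite.emptyI)
qed

text \<open>Finite traces are discarded because members of an almost disjoint family have to be
  infinite.\<close>

definition comb_traces :: "nat list set set \<Rightarrow> nat set set"
  where "comb_traces F =
    (\<lambda>n. comb_node -` column n) ` UNIV \<union> {X \<in> vimage comb_node ` F. infinite X}"

text \<open>The preimages of the columns are nonempty and pairwise disjoint, so they already form an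
  infinite subfamily.\<close>

lemma infinite_comb_traces: "infinite (comb_traces F)"
proof -
  have "inj (\<lambda>n. comb_node -` column n)"
  proof (rule injI, rule ccontr)
    fix m n assume eq: "comb_node -` column m = comb_node -` column n" and "m \<noteq> n"
    then have "comb_node -` column m \<inter> comb_node -` column n = {}"
      using column_disjoint by blast
    then show False using eq infinite_vimage_comb_node_column[of n] by simp
  qed
  then show ?thesis by (simp add: comb_traces_def finite_image_iff)
qed

lemma almost_disjoint_vimage_comb_node:
  assumes "almost_disjoint A B"
  shows "almost_disjoint (comb_node -` A) (comb_node -` B)"
  using finite_vimageI[OF _ inj_comb_node, of "A \<inter> B"] assms by (simp add: almost_disjoint_def)

text \<open>Almost disjointness passes to preimages under an injection. For maximality, a new set
  \<open>X\<close> would have an off-branch image on the comb; some member of \<open>F\<close> meets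
  that image infinitely, and its trace then meets \<open>X\<close> infinitely.\<close>

lemma maximal_almost_disjoint_family_comb_traces:
  assumes F: "maximal_off_branch_family F"
  shows "maximal_almost_disjoint_family (comb_traces F)"
  unfolding maximal_almost_disjoint_family_def
proof (intro conjI allI impI)
  have off: "\<And>A. A \<in> F \<Longrightarrow> off_branch A" and ad: "pairwise almost_disjoint F"
    using F by (simp_all add: maximal_off_branch_family_def off_branch_family_def)
  let ?Col = "range column"
  have ad_Un: "pairwise almost_disjoint (?Col \<union> F)"
  proof (rule pairwiseI)
    fix A B assume AB: "A \<in> ?Col \<union> F" "B \<in> ?Col \<union> F" "A \<noteq> B"
    consider "A \<in> ?Col" "B \<in> ?Col" | "A \<in> ?Col" "B \<in> F" | "A \<in> F" "B \<in> ?Col" | "A \<in> F" "B \<in> F"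
      using AB by blast
    then show "almost_disjoint A B"
    proof cases
      case 1
      then obtain m n where "A = column m" "B = column n" by blast
      then show ?thesis
        using \<open>A \<noteq> B\<close> column_disjoint[of m n]
        by (cases "m = n") (simp_all add: almost_disjoint_def)
    next
      case 2
      then show ?thesis
        using off off_branch_Int_column by (auto simp: almost_disjoint_def Int_commute)
    next
      case 3
      then show ?thesis
        using off off_branch_Int_column by (auto simp: almost_disjoint_def)
    next
      case 4
      then show ?thesis using ad \<open>A \<noteq> B\<close> by (simp add: pairwiseD)
    qed
  qed
  \<comment> \<open>The larger family on the right may also contain finite traces; pairwise almost
    disjointness is inherited by subfamilies.\<close>
  have "comb_traces F \<subseteq> vimage comb_node ` (?Col \<union> F)"
    by (auto simp: comb_traces_def)
  moreover have "pairwise almost_disjoint (vimage comb_node ` (?Col \<union> F))"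
    by (intro pairwise_imageI almost_disjoint_vimage_comb_node pairwiseD[OF ad_Un])
  ultimately have "pairwise almost_disjoint (comb_traces F)"
    using pairwise_subset by blast
  moreover have "\<forall>X\<in>comb_traces F. infinite X"
    using infinite_vimage_comb_node_column by (auto simp: comb_traces_def)
  ultimately show "almost_disjoint_family (comb_traces F)"
    by (simp add: almost_disjoint_family_def)
  fix G assume G: "almost_disjoint_family G \<and> comb_traces F \<subseteq> G"
  have "X \<in> comb_traces F" if "X \<in> G" for X
  proof (rule ccontr)
    assume "X \<notin> comb_traces F"
    have fin: "finite (X \<inter> Y)" if "Y \<in> comb_traces F" for Y
    proof -
      have "X \<noteq> Y" "Y \<in> G" "pairwise almost_disjoint G"
        using that G \<open>X \<notin> comb_traces F\<close> by (auto simp: almost_disjoint_family_def)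
      then show ?thesis
        using \<open>X \<in> G\<close> pairwiseD[of almost_disjoint G X Y] by (simp add: almost_disjoint_def)
    qed
    have image_Int: "comb_node ` X \<inter> B = comb_node ` (X \<inter> comb_node -` B)" for B
      by auto
    have "infinite (comb_node ` X)"
      using G \<open>X \<in> G\<close> inj_on_subset[OF inj_comb_node subset_UNIV]
      by (simp add: almost_disjoint_family_def finite_image_iff)
    \<comment> \<open>The preimages of the columns belong to the family, so \<open>X\<close> is
      almost disjoint from each of them.\<close>
    moreover have "finite (comb_node ` X \<inter> column n)" for n
      unfolding image_Int by (intro finite_imageI fin) (simp add: comb_traces_def)
    ultimately have "off_branch (comb_node ` X)"
      by (intro off_branchI_columns) auto
    then obtain B where B: "B \<in> F" "infinite (comb_node ` X \<inter> B)"
      using F by (auto simp: maximal_off_branch_family_def almost_disjoint_def)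
    then have inf: "infinite (X \<inter> comb_node -` B)"
      by (auto simp: image_Int)
    \<comment> \<open>The trace of \<open>B\<close> thus survives the restriction to infinite
      traces, so \<open>X\<close> must be almost disjoint from it.\<close>
    then have "infinite (comb_node -` B)" using finite_Int by blast
    then have "comb_node -` B \<in> comb_traces F"
      using B(1) by (auto simp: comb_traces_def)
    then show False using fin inf by blast
  qed
  then show "G = comb_traces F" using G by blast
qed

text \<open>There are countably many columns and at most |F| traces, and an infinite cardinal
  absorbs the union of two sets no larger than itself.\<close>

lemma card_of_comb_traces:
  assumes "infinite F"
  shows "|comb_traces F| \<le>o |F|"
proof -
  have "|range (\<lambda>n. comb_node -` column n)| \<le>o |F|"
    using card_of_image assms infinite_iff_card_of_nat ordLeq_transitive by blast
  moreover have "|{X \<in> vimage comb_node ` F. infinite X}| \<le>o |F|"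
    using card_of_mono1[of "{X \<in> vimage comb_node ` F. infinite X}" "vimage comb_node ` F"]
      card_of_image ordLeq_transitive by blast
  ultimately show ?thesis
    unfolding comb_traces_def using assms
    by (intro card_of_Un_ordLeq_infinite_Field card_of_Card_order) (simp_all add: Field_card_of)
qed

theorem theorem4p1:
  shows "cardinal_a \<le>o cardinal_o"
proof -
  obtain F where F: "maximal_off_branch_family F" "cardinal_o = |F|"
    using cardinal_o by blast
  have "cardinal_a \<le>o |comb_traces F|"
    using cardinal_a infinite_comb_traces maximal_almost_disjoint_family_comb_traces[OF F(1)]
    by metis
  then show ?thesis
    unfolding F(2)
    using card_of_comb_traces infinite_maximal_off_branch_family[OF F(1)] ordLeq_transitive
    by blast
qed

end
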